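(* Let $n,k,m$ be positive integers with $k\le n$, and let $f:\{0,1,\dots,m\}^n\rightarrow\mathbb{R}$ be convex. Then there exists a $k$-multihypergraph $H=[x,\dots,x]$ on $[n]$, having $m$ identical edges $x\in\{0,1\}^n_k$, which maximizes $f(\sum H)$ over all $k$-multihypergraphs with $m$ edges on $[n]$, where $x$ maximizes $f(mx)$ over $\{0,1\}^n_k$. Consequently, for any fixed $k$, the problem of finding, given $n,m$ and a convex $f:\{0,1,\dots,m\}^n\rightarrow\mathbb{R}$, a $k$-multihypergraph $H$ with $m$ edges on $[n]$ maximizing $f(\sum H)$ can be solved in polynomial time (polynomial in $n$ and $m$). On the other hand, when $k$ is variable (part of the input), the problem may need exponential time even for $m=1$: any algorithm solving it needs, in the worst case, time exponential in $n$ even when restricted to instances with $m=1$.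
   Context: Let $[n]:=\{1,\dots,n\}$ and $\{0,1\}^n_k:=\{x\in\{0,1\}^n:\|x\|_1=k\}$. A $k$-multihypergraph with $m$ edges on $[n]$ is a matrix $H=[H^1,\dots,H^m]\in\left(\{0,1\}^n_k\right)^m$, that is, an $n\times m$ matrix each of whose columns (edges) lies in $\{0,1\}^n_k$; repeated columns are allowed. Its degree sequence is $\sum H:=\sum_{j=1}^m H^j$. A function $f:\{0,1,\dots,m\}^n\rightarrow\mathbb{R}$ (not necessarily separable) is convex if it is the restriction of a convex function on $\mathbb{R}^n$; equivalently, $f(\sum_i\lambda_i z^i)\le\sum_i\lambda_i f(z^i)$ whenever $z^i$ and the convex combination $\sum_i\lambda_i z^i$ all lie in $\{0,1,\dots,m\}^n$. In particular every function on $\{0,1\}^n$ is convex. In the algorithmic statements $f$ is accessed through its values (an evaluation oracle: each query returns $f(z)$ for a queried point $z$, at unit cost, and comparison of values has unit cost). *)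

theory Defs
  imports Complex_Main "Jordan_Normal_Form.Matrix"
begin

section \<open>Convex functions on the grid and multihypergraphs\<close>

text \<open>Coordinates, vertices and edges are numbered from \<open>0\<close>, as usual for vectors and matrices
  of variable dimension; the vertex set is thus \<open>{0..<n}\<close>.\<close>

definition grid :: "nat \<Rightarrow> nat \<Rightarrow> nat vec set" where
  "grid n m = {z \<in> carrier_vec n. \<forall>i<n. z $ i \<le> m}"

definition cube_layer :: "nat \<Rightarrow> nat \<Rightarrow> nat vec set" where
  "cube_layer n k = {x \<in> carrier_vec n. (\<forall>i<n. x $ i \<in> {0, 1}) \<and> (\<Sum>i<n. x $ i) = k}"

definition multihypergraphs :: "nat \<Rightarrow> nat \<Rightarrow> nat \<Rightarrow> nat mat set" where
  "multihypergraphs n k m = {H \<in> carrier_mat n m. \<forall>j<m. col H j \<in> cube_layer n k}"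

definition degree_seq :: "nat mat \<Rightarrow> nat vec" where
  "degree_seq H = vec (dim_row H) (\<lambda>i. \<Sum>j<dim_col H. H $$ (i, j))"

definition convex_fun :: "nat \<Rightarrow> (real vec \<Rightarrow> real) \<Rightarrow> bool" where
  "convex_fun n g \<longleftrightarrow>
     (\<forall>x \<in> carrier_vec n. \<forall>y \<in> carrier_vec n. \<forall>t. 0 \<le> t \<and> t \<le> 1 \<longrightarrow>
        g (t \<cdot>\<^sub>v x + (1 - t) \<cdot>\<^sub>v y) \<le> t * g x + (1 - t) * g y)"

text \<open>Values of \<open>f\<close> outside \<^term>\<open>grid n m\<close> are irrelevant throughout.\<close>

definition convex_on_grid :: "nat \<Rightarrow> nat \<Rightarrow> (nat vec \<Rightarrow> real) \<Rightarrow> bool" where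
  "convex_on_grid n m f \<longleftrightarrow>
     (\<exists>g. convex_fun n g \<and> (\<forall>z \<in> grid n m. f z = g (map_vec real z)))"

definition admissible :: "nat \<Rightarrow> nat \<Rightarrow> nat \<Rightarrow> (nat vec \<Rightarrow> real) \<Rightarrow> bool" where
  "admissible n k m f \<longleftrightarrow> 1 \<le> k \<and> k \<le> n \<and> 1 \<le> m \<and> convex_on_grid n m f"

definition optimal :: "nat \<Rightarrow> nat \<Rightarrow> nat \<Rightarrow> (nat vec \<Rightarrow> real) \<Rightarrow> nat mat \<Rightarrow> bool" where
  "optimal n k m f H \<longleftrightarrow>
     is_arg_max (\<lambda>H. f (degree_seq H)) (\<lambda>H. H \<in> multihypergraphs n k m) H"

section \<open>Oracle algorithms and their running time\<close>

text \<open>Algorithms are deterministic programs for a random access machine.  Besides its memory of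
  natural numbers the machine has a memory of real numbers, which holds values returned by the
  oracle; these can only be copied and compared.  Both memories can be addressed indirectly
  through the natural number memory.  Every instruction and every test costs one time unit.  There
  is no multiplication, so that unit costs for natural numbers are realistic: in \<open>t\<close> steps
  only numbers of bit length linear in \<open>t\<close> and the input length can be produced.\<close>

datatype loc = Dir nat | Ind nat

datatype operand = Imm nat | At loc

datatype test = Le operand operand | ValLe loc loc

datatype prog =
    Skip
  | Add loc operand operand
  | Sub loc operand operand
  | CopyVal loc loc
  | Query loc operand
  | Seq prog prog
  | IfElse test prog prog
  | While test prog

record state =
  mem :: "nat \<Rightarrow> nat"
  vals :: "nat \<Rightarrow> real"

fun addr :: "state \<Rightarrow> loc \<Rightarrow> nat" where
  "addr s (Dir a) = a"
| "addr s (Ind a) = mem s a"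

fun opval :: "state \<Rightarrow> operand \<Rightarrow> nat" where
  "opval s (Imm c) = c"
| "opval s (At l) = mem s (addr s l)"

fun holds :: "state \<Rightarrow> test \<Rightarrow> bool" where
  "holds s (Le a b) \<longleftrightarrow> opval s a \<le> opval s b"
| "holds s (ValLe l l') \<longleftrightarrow> vals s (addr s l) \<le> vals s (addr s l')"

definition set_mem :: "loc \<Rightarrow> nat \<Rightarrow> state \<Rightarrow> state" where
  "set_mem l v s = s\<lparr>mem := (mem s)(addr s l := v)\<rparr>"

definition set_val :: "loc \<Rightarrow> real \<Rightarrow> state \<Rightarrow> state" where
  "set_val l v s = s\<lparr>vals := (vals s)(addr s l := v)\<rparr>"

text \<open>The query point is read from \<open>n\<close> consecutive memory cells.  The oracle knows \<open>f\<close> only on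
  \<^term>\<open>grid n m\<close>; queries outside of it return \<open>0\<close> and reveal nothing.\<close>

definition query_point :: "nat \<Rightarrow> state \<Rightarrow> nat \<Rightarrow> nat vec" where
  "query_point n s a = vec n (\<lambda>i. mem s (a + i))"

definition oracle_answer :: "nat \<Rightarrow> nat \<Rightarrow> (nat vec \<Rightarrow> real) \<Rightarrow> nat vec \<Rightarrow> real" where
  "oracle_answer n m f z = (if z \<in> grid n m then f z else 0)"

text \<open>\<open>exec n m f P s t s'\<close>: started in state \<open>s\<close> with an oracle for \<open>f\<close> on \<^term>\<open>grid n m\<close>,
  the program \<open>P\<close> halts after exactly \<open>t\<close> time units in state \<open>s'\<close>.\<close>

inductive exec ::
  "nat \<Rightarrow> nat \<Rightarrow> (nat vec \<Rightarrow> real) \<Rightarrow> prog \<Rightarrow> state \<Rightarrow> nat \<Rightarrow> state \<Rightarrow> bool"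
  for n m :: nat and f :: "nat vec \<Rightarrow> real"
where
  Skip: "exec n m f Skip s 1 s"
| Add: "exec n m f (Add l a b) s 1 (set_mem l (opval s a + opval s b) s)"
| Sub: "exec n m f (Sub l a b) s 1 (set_mem l (opval s a - opval s b) s)"
| CopyVal: "exec n m f (CopyVal l l') s 1 (set_val l (vals s (addr s l')) s)"
| Query: "exec n m f (Query l a) s 1
            (set_val l (oracle_answer n m f (query_point n s (opval s a))) s)"
| Seq: "exec n m f P s t s' \<Longrightarrow> exec n m f Q s' t' s'' \<Longrightarrow> exec n m f (Seq P Q) s (t + t') s''"
| IfTrue: "holds s b \<Longrightarrow> exec n m f P s t s' \<Longrightarrow> exec n m f (IfElse b P Q) s (1 + t) s'"
| IfFalse: "\<not> holds s b \<Longrightarrow> exec n m f Q s t s' \<Longrightarrow> exec n m f (IfElse b P Q) s (1 + t) s'"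
| WhileFalse: "\<not> holds s b \<Longrightarrow> exec n m f (While b P) s 1 s"
| WhileTrue: "holds s b \<Longrightarrow> exec n m f P s t s' \<Longrightarrow> exec n m f (While b P) s' t' s'' \<Longrightarrow>
    exec n m f (While b P) s (1 + t + t') s''"

inductive_cases exec_elims:
  "exec n m f Skip s t s'"
  "exec n m f (Add l a b) s t s'"
  "exec n m f (Sub l a b) s t s'"
  "exec n m f (CopyVal l l') s t s'"
  "exec n m f (Query l a) s t s'"
  "exec n m f (Seq P Q) s t s'"
  "exec n m f (IfElse b P Q) s t s'"
  "exec n m f (While b P) s t s'"

text \<open>The machine is deterministic, so \<^const>\<open>exec\<close> assigns to each halting run one running time
  and one result.\<close>

lemma exec_deterministic:
  assumes "exec n m f P s t s'" "exec n m f P s u s''"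
  shows "u = t \<and> s'' = s'"
  using assms
proof (induction arbitrary: u s'' rule: exec.induct)
  case (Skip s)
  then show ?case by (rule exec_elims(1)) simp
next
  case (Add l a b s)
  then show ?case by (rule exec_elims(2)) simp
next
  case (Sub l a b s)
  then show ?case by (rule exec_elims(3)) simp
next
  case (CopyVal l l' s)
  then show ?case by (rule exec_elims(4)) simp
next
  case (Query l a s)
  then show ?case by (rule exec_elims(5)) simp
next
  case (Seq P s t s' Q t' r)
  from Seq.prems show ?case by (rule exec_elims(6)) (auto dest!: Seq.IH)
next
  case (IfTrue s b P t s' Q)
  from IfTrue.prems show ?case by (rule exec_elims(7)) (auto simp: IfTrue.hyps(1) dest!: IfTrue.IH)
next
  case (IfFalse s b Q t s' P)
  from IfFalse.prems show ?case by (rule exec_elims(7)) (auto simp: IfFalse.hyps(1) dest!: IfFalse.IH)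
next
  case (WhileFalse s b P)
  from WhileFalse.prems show ?case by (rule exec_elims(8)) (auto simp: WhileFalse.hyps(1))
next
  case (WhileTrue s b P t s' t' r)
  from WhileTrue.prems show ?case
    by (rule exec_elims(8)) (auto simp: WhileTrue.hyps(1) dest!: WhileTrue.IH)
qed

definition initial_state :: "nat \<Rightarrow> nat \<Rightarrow> nat \<Rightarrow> state" where
  "initial_state n k m = \<lparr>mem = (\<lambda>_. 0)(0 := n, 1 := k, 2 := m), vals = (\<lambda>_. 0)\<rparr>"

text \<open>On halting, cell \<open>0\<close> holds the address from which on the matrix is stored column by column.\<close>

definition output_matrix :: "nat \<Rightarrow> nat \<Rightarrow> state \<Rightarrow> nat mat" where
  "output_matrix n m s = mat n m (\<lambda>(i, j). mem s (mem s 0 + j * n + i))"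

definition solves_in :: "prog \<Rightarrow> nat \<Rightarrow> nat \<Rightarrow> nat \<Rightarrow> (nat vec \<Rightarrow> real) \<Rightarrow> nat \<Rightarrow> bool" where
  "solves_in P n k m f t \<longleftrightarrow>
     (\<exists>s. exec n m f P (initial_state n k m) t s \<and> optimal n k m f (output_matrix n m s))"

end

theory Submission imports Defs begin

text \<open>The degree sequence of a multihypergraph \<open>H\<close> with \<open>m\<close> edges is the average of the points
  \<open>m \<cdot>\<^sub>v H\<^sup>j\<close> over its edges \<open>H\<^sup>j\<close>.  A convex function takes at an average at most the largest of
  its values at the averaged points, so some single edge, repeated \<open>m\<close> times, is at least as good as
  \<open>H\<close> (\<open>optimal_replicate\<close>).  This is the structural statement.

  It also reduces the optimization problem to comparing the values \<open>f (m \<cdot>\<^sub>v x)\<close> for the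
  \<open>n choose k\<close> elements \<open>x\<close> of the cube layer.  For fixed \<open>k\<close> these are at most \<open>n ^ k\<close> many, and a
  program with \<open>k\<close> nested loops visits them all.  Its correctness and its running time are
  proved together with a calculus of total correctness with time bounds: \<open>enumerate_halts\<close> treats
  the nested loops by induction on their number, \<open>write_output_halts\<close> the output, and
  \<open>solver_polynomial\<close> draws the conclusion.

  For variable \<open>k\<close> and \<open>m = 1\<close> an adversary argument applies.  On the vertices of the cube both the
  zero function and the indicator function of a single vertex are restrictions of convex functions.
  A program that, on the zero function, leaves some element of the cube layer neither queried nor
  output behaves in the same way on the indicator function of that element, where its output is
  wrong.  Hence a correct program needs at least \<open>(n choose k) - 1\<close> steps on the zero function
  (\<open>binomial_le_solver_time\<close>), which for \<open>k = n div 2\<close> is exponential in \<open>n\<close>.\<close>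

section \<open>Averaging over the edges\<close>

text \<open>Jensen's inequality for equal weights, in the form that a convex function is bounded on an
  average by any bound on the averaged points.  Adding one more point mixes the old average, with
  weight \<open>(r + 1) / (r + 2)\<close>, with the new point.\<close>

lemma convex_fun_mean_le:
  assumes g: "convex_fun n g"
    and y: "\<And>j. j \<le> r \<Longrightarrow> y j \<in> carrier_vec n \<and> g (y j) \<le> M"
  shows "g (vec n (\<lambda>i. (\<Sum>j\<le>r. y j $ i) / real (Suc r))) \<le> M"
  using y
proof (induction r)
  case 0
  then have "vec n (\<lambda>i. (\<Sum>j\<le>0. y j $ i) / real (Suc 0)) = y 0"
    by (intro eq_vecI) auto
  then show ?case using 0 by simp
next
  case (Suc r)
  define t :: real where "t = real (Suc r) / real (Suc (Suc r))"
  define a where "a = vec n (\<lambda>i. (\<Sum>j\<le>r. y j $ i) / real (Suc r))"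
  have t: "0 \<le> t" "t \<le> 1" and t1: "1 - t = 1 / real (Suc (Suc r))"
    by (auto simp: t_def field_simps)
  have yS: "y (Suc r) \<in> carrier_vec n" "g (y (Suc r)) \<le> M" using Suc.prems by auto
  have split: "vec n (\<lambda>i. (\<Sum>j\<le>Suc r. y j $ i) / real (Suc (Suc r)))
      = t \<cdot>\<^sub>v a + (1 - t) \<cdot>\<^sub>v y (Suc r)"
    unfolding t1 using yS
    by (intro eq_vecI) (auto simp: a_def t_def add_divide_distrib simp del: of_nat_Suc)
  have a: "a \<in> carrier_vec n" "g a \<le> M"
    using Suc.IH Suc.prems by (auto simp: a_def)
  have "g (t \<cdot>\<^sub>v a + (1 - t) \<cdot>\<^sub>v y (Suc r)) \<le> t * g a + (1 - t) * g (y (Suc r))"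
    using g a(1) yS(1) t unfolding convex_fun_def by blast
  also have "\<dots> \<le> t * M + (1 - t) * M"
    using a yS t by (intro add_mono mult_left_mono) auto
  finally show ?case unfolding split by (simp add: algebra_simps)
qed

lemma degree_seq_replicate:
  assumes "x \<in> carrier_vec n"
  shows "degree_seq (mat_of_cols n (replicate m x)) = m \<cdot>\<^sub>v x"
  using assms by (intro eq_vecI) (auto simp: degree_seq_def mat_of_cols_index)

lemma replicate_in_multihypergraphs:
  assumes "x \<in> cube_layer n k"
  shows "mat_of_cols n (replicate m x) \<in> multihypergraphs n k m"
  using assms by (auto simp: multihypergraphs_def cube_layer_def)

lemma smult_cube_layer_in_grid:
  assumes "x \<in> cube_layer n k"
  shows "m \<cdot>\<^sub>v x \<in> grid n m"
  using assms by (force simp: cube_layer_def grid_def)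

text \<open>The degree sequence of a multihypergraph is the average of the \<open>m\<close> points
  \<open>m \<cdot>\<^sub>v H\<^sup>j\<close>, where \<open>H\<^sup>j\<close> runs through its edges.  By convexity it does no better than the
  best of these points, and each of them is itself a degree sequence, that of \<open>m\<close> copies of one
  edge.\<close>

lemma optimal_replicate:
  assumes f: "convex_on_grid n m f" and m: "1 \<le> m"
    and x: "is_arg_max (\<lambda>x. f (m \<cdot>\<^sub>v x)) (\<lambda>x. x \<in> cube_layer n k) x"
  shows "optimal n k m f (mat_of_cols n (replicate m x))"
proof -
  obtain g where g: "convex_fun n g" and fg: "\<And>z. z \<in> grid n m \<Longrightarrow> f z = g (map_vec real z)"
    using f by (auto simp: convex_on_grid_def)
  obtain r where r: "m = Suc r" using m by (cases m) auto
  have xk: "x \<in> cube_layer n k" and xc: "x \<in> carrier_vec n"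
    using x by (auto simp: is_arg_max_def cube_layer_def)
  have "f (degree_seq H) \<le> f (m \<cdot>\<^sub>v x)" if H: "H \<in> multihypergraphs n k m" for H
  proof -
    have dim: "dim_row H = n" "dim_col H = m"
      and cols: "\<And>j. j < m \<Longrightarrow> col H j \<in> cube_layer n k"
      using H by (auto simp: multihypergraphs_def)
    have entry: "H $$ (i, j) \<le> 1" if "i < n" "j < m" for i j
    proof -
      have "col H j $ i \<in> {0, 1}"
        using cols[OF that(2)] that(1) unfolding cube_layer_def by blast
      then show ?thesis using that dim by auto
    qed
    have "(\<Sum>j<m. H $$ (i, j)) \<le> m" if "i < n" for i
      using sum_bounded_above[of "{..<m}" "\<lambda>j. H $$ (i, j)" 1] entry[OF that] by auto
    then have deg: "degree_seq H \<in> grid n m"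
      by (auto simp: grid_def degree_seq_def dim)
    define y where "y j = map_vec real (m \<cdot>\<^sub>v col H j)" for j
    have y: "y j \<in> carrier_vec n \<and> g (y j) \<le> f (m \<cdot>\<^sub>v x)" if "j \<le> r" for j
    proof -
      have j: "col H j \<in> cube_layer n k" using cols that r by simp
      then have "f (m \<cdot>\<^sub>v col H j) \<le> f (m \<cdot>\<^sub>v x)"
        using x by (simp add: is_arg_max_linorder)
      then have "g (y j) \<le> f (m \<cdot>\<^sub>v x)"
        unfolding y_def fg[OF smult_cube_layer_in_grid[OF j], symmetric] .
      moreover have "y j \<in> carrier_vec n"
        by (rule carrier_vecI) (simp add: y_def dim)
      ultimately show ?thesis by blast
    qed
    have "g (vec n (\<lambda>i. (\<Sum>j\<le>r. y j $ i) / real (Suc r))) \<le> f (m \<cdot>\<^sub>v x)"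
      using g y by (rule convex_fun_mean_le)
    also have "vec n (\<lambda>i. (\<Sum>j\<le>r. y j $ i) / real (Suc r)) = map_vec real (degree_seq H)"
    proof (rule eq_vecI)
      fix i assume "i < dim_vec (map_vec real (degree_seq H))"
      then have i: "i < n" by (simp add: degree_seq_def dim)
      have "(\<Sum>j\<le>r. y j $ i) = (\<Sum>j\<le>r. real m * real (H $$ (i, j)))"
        using i dim r by (intro sum.cong) (auto simp: y_def algebra_simps)
      also have "\<dots> = real m * real (\<Sum>j<m. H $$ (i, j))"
        unfolding r lessThan_Suc_atMost by (simp add: sum_distrib_left)
      finally show "vec n (\<lambda>i. (\<Sum>j\<le>r. y j $ i) / real (Suc r)) $ i
          = map_vec real (degree_seq H) $ i"
        using i m by (simp add: degree_seq_def dim flip: r)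
    qed (simp add: degree_seq_def dim)
    finally show ?thesis using fg[OF deg] by simp
  qed
  then show ?thesis
    unfolding optimal_def is_arg_max_linorder degree_seq_replicate[OF xc]
    using replicate_in_multihypergraphs[OF xk] by auto
qed

section \<open>Edges as sets of positions\<close>

text \<open>Edges are handled as sets of positions.  Positions are counted from 1, so that 0 can serve as
  the position before the first one in the enumeration below.\<close>

definition scaled_indicator :: "nat \<Rightarrow> nat \<Rightarrow> nat set \<Rightarrow> nat vec" where
  "scaled_indicator n m X = vec n (\<lambda>i. if Suc i \<in> X then m else 0)"

definition positions :: "nat \<Rightarrow> nat \<Rightarrow> nat set set" where
  "positions n k = {X. X \<subseteq> {1..n} \<and> card X = k}"

lemma finite_positions [simp]: "finite (positions n k)"
  by (rule finite_subset[of _ "Pow {1..n}"]) (auto simp: positions_def)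

lemma sum_Suc_indicator:
  assumes "X \<subseteq> {1..n}"
  shows "(\<Sum>i<n. if Suc i \<in> X then 1 else 0) = card X"
proof -
  have "Suc ` {i. i < n \<and> Suc i \<in> X} = X"
  proof (intro equalityI subsetI)
    fix x assume "x \<in> X"
    moreover from this assms obtain i where "x = Suc i" "i < n"
      by (cases x) auto
    ultimately show "x \<in> Suc ` {i. i < n \<and> Suc i \<in> X}" by auto
  qed auto
  then have "card {i. i < n \<and> Suc i \<in> X} = card X"
    by (metis card_image inj_Suc)
  moreover have "(\<Sum>i<n. if Suc i \<in> X then 1 else 0) = card ({..<n} \<inter> {i. Suc i \<in> X})"
    by (simp add: sum.If_cases)
  moreover have "{..<n} \<inter> {i. Suc i \<in> X} = {i. i < n \<and> Suc i \<in> X}" by auto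
  ultimately show ?thesis by simp
qed

lemma cube_layer_eq_image: "cube_layer n k = scaled_indicator n 1 ` positions n k"
proof (intro equalityI subsetI)
  fix x assume x: "x \<in> cube_layer n k"
  define X where "X = {p \<in> {1..n}. x $ (p - 1) = 1}"
  have eq: "x = scaled_indicator n 1 X"
    using x by (intro eq_vecI) (auto simp: cube_layer_def X_def scaled_indicator_def)
  have "card X = (\<Sum>i<n. if Suc i \<in> X then 1 else 0)"
    by (rule sum_Suc_indicator[symmetric]) (auto simp: X_def)
  also have "\<dots> = (\<Sum>i<n. x $ i)"
    by (subst eq) (auto simp: scaled_indicator_def intro!: sum.cong)
  finally have "X \<in> positions n k" using x by (auto simp: positions_def X_def cube_layer_def)
  with eq show "x \<in> scaled_indicator n 1 ` positions n k" by blast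
next
  fix x assume "x \<in> scaled_indicator n 1 ` positions n k"
  then show "x \<in> cube_layer n k"
    by (auto simp: scaled_indicator_def positions_def cube_layer_def
        sum_Suc_indicator[unfolded One_nat_def])
qed

lemma inj_on_scaled_indicator: "inj_on (scaled_indicator n 1) (positions n k)"
proof (rule inj_onI)
  fix X Y
  assume X: "X \<in> positions n k" and Y: "Y \<in> positions n k"
    and eq: "scaled_indicator n 1 X = scaled_indicator n 1 Y"
  have "p \<in> X \<longleftrightarrow> p \<in> Y" for p
  proof (cases "p \<in> {1..n}")
    case True
    then show ?thesis
      using arg_cong[OF eq, of "\<lambda>v. v $ (p - 1)"]
      by (auto simp: scaled_indicator_def split: if_splits)
  qed (use X Y in \<open>auto simp: positions_def\<close>)
  then show "X = Y" by blast
qed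

lemma card_cube_layer: "card (cube_layer n k) = n choose k"
  using n_subsets[of "{1..n}" k]
  by (simp only: cube_layer_eq_image card_image[OF inj_on_scaled_indicator])
     (simp add: positions_def)

lemma finite_cube_layer [simp]: "finite (cube_layer n k)"
  by (simp add: cube_layer_eq_image)

lemma smult_scaled_indicator [simp]:
  "m \<cdot>\<^sub>v scaled_indicator n c X = scaled_indicator n (m * c) X"
  by (auto simp: scaled_indicator_def)

lemma exists_replicate_optimal:
  assumes "admissible n k m f"
  obtains x where "is_arg_max (\<lambda>x. f (m \<cdot>\<^sub>v x)) (\<lambda>x. x \<in> cube_layer n k) x"
    and "optimal n k m f (mat_of_cols n (replicate m x))"
proof -
  have "card (cube_layer n k) \<noteq> 0"
    using assms by (simp add: card_cube_layer admissible_def)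
  then have ne: "cube_layer n k \<noteq> {}" by auto
  then have "Max ((\<lambda>x. f (m \<cdot>\<^sub>v x)) ` cube_layer n k) \<in> (\<lambda>x. f (m \<cdot>\<^sub>v x)) ` cube_layer n k"
    by (intro Max_in) auto
  then obtain x where "x \<in> cube_layer n k"
      "f (m \<cdot>\<^sub>v x) = Max ((\<lambda>x. f (m \<cdot>\<^sub>v x)) ` cube_layer n k)" by auto
  then have "is_arg_max (\<lambda>x. f (m \<cdot>\<^sub>v x)) (\<lambda>x. x \<in> cube_layer n k) x"
    unfolding is_arg_max_linorder by auto
  then show thesis using that assms optimal_replicate by (auto simp: admissible_def)
qed

section \<open>Total correctness with time bounds\<close>

definition halts_within ::
  "nat \<Rightarrow> nat \<Rightarrow> (nat vec \<Rightarrow> real) \<Rightarrow> prog \<Rightarrow> state \<Rightarrow> nat \<Rightarrow> (state \<Rightarrow> bool) \<Rightarrow> bool" where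
  "halts_within n m f P s T Q \<longleftrightarrow> (\<exists>t s'. exec n m f P s t s' \<and> t \<le> T \<and> Q s')"

context
  fixes n m :: nat and f :: "nat vec \<Rightarrow> real"
begin

abbreviation "halts \<equiv> halts_within n m f"

lemma halts_weaken:
  assumes "halts P s T Q" "T \<le> T'" "\<And>s'. Q s' \<Longrightarrow> Q' s'"
  shows "halts P s T' Q'"
  using assms unfolding halts_within_def by (meson order_trans)

lemma halts_exec: "exec n m f P s t s' \<Longrightarrow> Q s' \<Longrightarrow> halts P s t Q"
  unfolding halts_within_def by blast

lemmas halts_Skip = halts_exec[OF exec.Skip]
  and halts_Add = halts_exec[OF exec.Add]
  and halts_Sub = halts_exec[OF exec.Sub]
  and halts_CopyVal = halts_exec[OF exec.CopyVal]
  and halts_Query = halts_exec[OF exec.Query]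

lemma halts_Seq:
  assumes "halts P s T R" "\<And>s'. R s' \<Longrightarrow> halts P' s' T' Q"
  shows "halts (Seq P P') s (T + T') Q"
proof -
  obtain t s' where 1: "exec n m f P s t s'" "t \<le> T" "R s'"
    using assms(1) by (auto simp: halts_within_def)
  obtain t' s'' where 2: "exec n m f P' s' t' s''" "t' \<le> T'" "Q s''"
    using assms(2)[OF 1(3)] by (auto simp: halts_within_def)
  have "t + t' \<le> T + T'" using 1(2) 2(2) by (rule add_mono)
  then show ?thesis
    using exec.Seq[OF 1(1) 2(1)] 2(3) unfolding halts_within_def by blast
qed

lemma halts_IfElse:
  assumes "holds s b \<Longrightarrow> halts P s T Q" "\<not> holds s b \<Longrightarrow> halts P' s T Q"
  shows "halts (IfElse b P P') s (1 + T) Q"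
proof (cases "holds s b")
  case True
  with assms(1) obtain t s' where "exec n m f P s t s'" "t \<le> T" "Q s'"
    by (auto simp: halts_within_def)
  then show ?thesis
    using exec.IfTrue[OF True] unfolding halts_within_def by (metis add_le_cancel_left)
next
  case False
  with assms(2) obtain t s' where "exec n m f P' s t s'" "t \<le> T" "Q s'"
    by (auto simp: halts_within_def)
  then show ?thesis
    using exec.IfFalse[OF False] unfolding halts_within_def by (metis add_le_cancel_left)
qed

text \<open>Total correctness of a loop whose number \<open>N\<close> of rounds is known in advance; \<open>I i\<close> holds after
  \<open>i\<close> rounds.\<close>

lemma halts_While:
  assumes start: "I 0 s"
    and continue: "\<And>i s. i < N \<Longrightarrow> I i s \<Longrightarrow> holds s b"
    and body: "\<And>i s. i < N \<Longrightarrow> I i s \<Longrightarrow> halts P s T (I (Suc i))"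
    and stop: "\<And>s. I N s \<Longrightarrow> \<not> holds s b"
  shows "halts (While b P) s (N * (1 + T) + 1) (I N)"
proof -
  have "halts (While b P) s ((N - i) * (1 + T) + 1) (I N)" if "i \<le> N" "I i s" for i s
    using that
  proof (induction i arbitrary: s rule: inc_induct)
    case base
    then show ?case
      using exec.WhileFalse[OF stop[OF base]] by (auto intro!: halts_exec)
  next
    case (step i)
    obtain t s' where 1: "exec n m f P s t s'" "t \<le> T" "I (Suc i) s'"
      using body[OF step.hyps(2) step.prems] by (auto simp: halts_within_def)
    obtain t' s'' where 2: "exec n m f (While b P) s' t' s''"
        "t' \<le> (N - Suc i) * (1 + T) + 1" "I N s''"
      using step.IH[OF 1(3)] by (auto simp: halts_within_def)
    have "exec n m f (While b P) s (1 + t + t') s''"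
      using exec.WhileTrue[OF continue 1(1) 2(1)] step.hyps step.prems by blast
    moreover have "N - i = Suc (N - Suc i)" using step.hyps by simp
    then have "1 + t + t' \<le> (N - i) * (1 + T) + 1" using 1(2) 2(2) by simp
    ultimately show ?case using 2(3) unfolding halts_within_def by blast
  qed
  from this[of 0 s] start show ?thesis by simp
qed

end

lemma set_mem_simps [simp]:
  "mem (set_mem l v s) = (mem s)(addr s l := v)" "vals (set_mem l v s) = vals s"
  by (auto simp: set_mem_def)

lemma set_val_simps [simp]:
  "vals (set_val l v s) = (vals s)(addr s l := v)" "mem (set_val l v s) = mem s"
  by (auto simp: set_val_def)

section \<open>The enumeration program\<close>

text \<open>The program for a fixed \<open>k\<close> consists of \<open>k\<close> nested loops that run through all choices
  of \<open>k\<close> positions in increasing order, the outermost loop choosing the smallest one.  A counter holds not the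
  position \<open>p\<close> itself but the address \<open>base k + p\<close> of the entry for \<open>p\<close> in the current query point,
  so that indirect addressing sets that entry without further computation.  The memory is used as
  follows.

  \<^item> Cells 0 and 2 hold \<open>n\<close> and \<open>m\<close>, and cell 3 holds \<open>base k + n\<close>, the last admissible counter.
  \<^item> Cell 1, initially \<open>k\<close> and hence positive, becomes 0 once some point has been queried.
  \<^item> Cell \<open>4 + l\<close> with \<open>l < k\<close> is the counter of the loop that has \<open>l\<close> loops inside it.
    Every loop starts one after the content of the cell that follows its counter; for the outermost
    loop this is cell \<open>4 + k\<close>, which holds \<open>base k\<close>.
  \<^item> Cells \<open>5 + k + l\<close> with \<open>l < k\<close> hold the counters of the best point found so far.
  \<^item> The query point occupies the cells after \<open>base k\<close>, and the output matrix the cells after it.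

  Value cell 0 receives the oracle's answers and value cell 1 the best one.\<close>

definition base :: "nat \<Rightarrow> nat" where
  "base k = 4 + 2 * k"

primrec save_counters :: "nat \<Rightarrow> nat \<Rightarrow> prog" where
  "save_counters k 0 = Skip"
| "save_counters k (Suc l) =
     Seq (save_counters k l) (Add (Dir (5 + k + l)) (At (Dir (4 + l))) (Imm 0))"

definition record_incumbent :: "nat \<Rightarrow> prog" where
  "record_incumbent k =
     Seq (CopyVal (Dir 1) (Dir 0)) (Seq (Add (Dir 1) (Imm 0) (Imm 0)) (save_counters k k))"

text \<open>The first answer is recorded unconditionally, because the initial content 0 of value cell 1
  need not be a lower bound for \<open>f\<close>.\<close>

definition visit :: "nat \<Rightarrow> prog" where
  "visit k =
     Seq (Query (Dir 0) (Imm (base k + 1)))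
       (IfElse (Le (Imm 1) (At (Dir 1))) (record_incumbent k)
         (IfElse (ValLe (Dir 1) (Dir 0)) (record_incumbent k) Skip))"

primrec enumerate :: "nat \<Rightarrow> nat \<Rightarrow> prog" where
  "enumerate k 0 = visit k"
| "enumerate k (Suc d) =
     Seq (Add (Dir (4 + d)) (At (Dir (5 + d))) (Imm 1))
       (While (Le (At (Dir (4 + d))) (At (Dir 3)))
         (Seq (Add (Ind (4 + d)) (At (Dir 2)) (Imm 0))
         (Seq (enumerate k d)
         (Seq (Add (Ind (4 + d)) (Imm 0) (Imm 0))
              (Add (Dir (4 + d)) (At (Dir (4 + d))) (Imm 1))))))"

text \<open>Adding \<open>n\<close> to the address of an entry in the query point, or in a column of the output matrix,
  gives the address of the same entry in the next column.  The recorded counters are thus moved from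
  column to column, and no multiplication is needed.\<close>

primrec write_column :: "nat \<Rightarrow> nat \<Rightarrow> prog" where
  "write_column k 0 = Skip"
| "write_column k (Suc l) =
     Seq (write_column k l)
       (Seq (Add (Dir (5 + k + l)) (At (Dir (5 + k + l))) (At (Dir 0)))
            (Add (Ind (5 + k + l)) (Imm 1) (Imm 0)))"

definition write_output :: "nat \<Rightarrow> prog" where
  "write_output k =
     Seq (While (Le (Imm 1) (At (Dir 2)))
           (Seq (write_column k k) (Sub (Dir 2) (At (Dir 2)) (Imm 1))))
         (Add (Dir 0) (At (Dir 0)) (Imm (base k + 1)))"

definition solver :: "nat \<Rightarrow> prog" where
  "solver k =
     Seq (Add (Dir 3) (At (Dir 0)) (Imm (base k)))
     (Seq (Add (Dir (4 + k)) (Imm (base k)) (Imm 0))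
     (Seq (enumerate k k) (write_output k)))"

section \<open>Correctness and running time of the program\<close>

text \<open>These are the sets that the \<open>d\<close> innermost loops visit when the outer loops have chosen \<open>S\<close>
  and only the positions after \<open>q\<close> are still to be tried.\<close>

definition extensions :: "nat \<Rightarrow> nat \<Rightarrow> nat \<Rightarrow> nat set \<Rightarrow> nat set set" where
  "extensions n d q S = {S \<union> T |T. T \<subseteq> {q<..n} \<and> card T = d}"

lemma extensions_0 [simp]: "extensions n 0 q S = {S}"
proof -
  have "T \<subseteq> {q<..n} \<and> card T = 0 \<longleftrightarrow> T = {}" for T :: "nat set"
    by (auto dest: finite_subset)
  then show ?thesis by (auto simp: extensions_def)
qed

text \<open>The sets are sorted by the smallest position that is added to \<open>S\<close>; this is the choice made by
  the outermost of the \<open>Suc d\<close> loops.\<close>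

lemma extensions_Suc:
  "extensions n (Suc d) q S = (\<Union>p\<in>{q<..n}. extensions n d p (insert p S))"
proof (intro equalityI subsetI)
  fix X assume "X \<in> extensions n (Suc d) q S"
  then obtain T where T: "X = S \<union> T" "T \<subseteq> {q<..n}" "card T = Suc d"
    by (auto simp: extensions_def)
  have fin: "finite T" and ne: "T \<noteq> {}" using T by (auto intro: finite_subset)
  define p where "p = Min T"
  have p: "p \<in> T" "\<And>x. x \<in> T \<Longrightarrow> p \<le> x" using fin ne by (auto simp: p_def)
  have "T - {p} \<subseteq> {p<..n}" using T(2) p(2) by fastforce
  moreover have "card (T - {p}) = d" using T(3) p(1) fin by simp
  moreover have "X = insert p S \<union> (T - {p})" using T(1) p(1) by auto
  ultimately have "X \<in> extensions n d p (insert p S)" unfolding extensions_def by blast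
  then show "X \<in> (\<Union>p\<in>{q<..n}. extensions n d p (insert p S))" using p(1) T(2) by blast
next
  fix X assume "X \<in> (\<Union>p\<in>{q<..n}. extensions n d p (insert p S))"
  then obtain p T where p: "q < p" "p \<le> n" and T: "X = insert p S \<union> T" "T \<subseteq> {p<..n}" "card T = d"
    by (auto simp: extensions_def)
  have "finite T" "p \<notin> T" using T(2) by (auto intro: finite_subset)
  then have "card (insert p T) = Suc d" using T(3) by simp
  moreover have "insert p T \<subseteq> {q<..n}" using T(2) p by auto
  moreover have "X = S \<union> insert p T" using T(1) by auto
  ultimately show "X \<in> extensions n (Suc d) q S" unfolding extensions_def by blast
qed

lemma extensions_empty: "extensions n k 0 {} = positions n k"
proof -
  have "{0<..n} = {1..n}" by auto
  then show ?thesis by (simp add: extensions_def positions_def)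
qed

lemma image_fun_upd_first:
  assumes "d < k"
  shows "C(d := p) ` {d..<k} = insert p (C ` {Suc d..<k})"
proof -
  have "{d..<k} = insert d {Suc d..<k}" using assms by auto
  then show ?thesis by auto
qed

text \<open>The copy of a counter lies \<open>k + 1\<close> cells after it.\<close>

lemma save_counters_halts:
  assumes "l \<le> k"
  shows "halts_within n m f (save_counters k l) s (l + 1)
    (\<lambda>s'. vals s' = vals s \<and>
      mem s' = (\<lambda>a. if 5 + k \<le> a \<and> a < 5 + k + l then mem s (a - (k + 1)) else mem s a))"
  using assms
proof (induction l)
  case 0
  have "halts_within n m f Skip s 1 (\<lambda>s'. s' = s)" by (rule halts_Skip) simp
  then show ?case unfolding save_counters.simps by (rule halts_weaken) auto
next
  case (Suc l)
  have "halts_within n m f (save_counters k (Suc l)) s (l + 1 + 1)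
    (\<lambda>s'. vals s' = vals s \<and>
      mem s' = (\<lambda>a. if 5 + k \<le> a \<and> a < 5 + k + Suc l then mem s (a - (k + 1)) else mem s a))"
    unfolding save_counters.simps
  proof (rule halts_Seq[OF Suc.IH])
    show "l \<le> k" using Suc.prems by simp
    fix s' :: state assume s': "vals s' = vals s \<and>
      mem s' = (\<lambda>a. if 5 + k \<le> a \<and> a < 5 + k + l then mem s (a - (k + 1)) else mem s a)"
    show "halts_within n m f (Add (Dir (5 + k + l)) (At (Dir (4 + l))) (Imm 0)) s' 1
      (\<lambda>s'. vals s' = vals s \<and>
        mem s' = (\<lambda>a. if 5 + k \<le> a \<and> a < 5 + k + Suc l then mem s (a - (k + 1)) else mem s a))"
      using s' Suc.prems by (intro halts_Add) (auto simp: fun_eq_iff)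
  qed
  then show ?case by simp
qed

context
  fixes n m k :: nat and f :: "nat vec \<Rightarrow> real"
begin

definition incumbent :: "nat set set \<Rightarrow> state \<Rightarrow> bool" where
  "incumbent V s \<longleftrightarrow>
     (V = {} \<longrightarrow> 1 \<le> mem s 1) \<and>
     (V \<noteq> {} \<longrightarrow> mem s 1 = 0 \<and>
        (\<exists>X\<in>V. vals s 1 = f (scaled_indicator n m X) \<and>
           (\<lambda>l. mem s (5 + k + l)) ` {..<k} = (+) (base k) ` X) \<and>
        (\<forall>Y\<in>V. f (scaled_indicator n m Y) \<le> vals s 1))"

text \<open>The state at a moment when the outer loops have fixed the counters \<open>C l\<close> for \<open>d \<le> l < k\<close> and
  the sets in \<open>V\<close> have been visited.  The clause about the cells after \<open>base k\<close> has no upper bound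
  on \<open>p\<close>: it also says that the space for the output is still zero.\<close>

definition enum_inv :: "nat \<Rightarrow> (nat \<Rightarrow> nat) \<Rightarrow> nat set set \<Rightarrow> state \<Rightarrow> bool" where
  "enum_inv d C V s \<longleftrightarrow>
     mem s 0 = n \<and> mem s 2 = m \<and> mem s 3 = base k + n \<and>
     (\<forall>l. d \<le> l \<and> l \<le> k \<longrightarrow> mem s (4 + l) = base k + C l) \<and>
     (\<forall>p>0. mem s (base k + p) = (if p \<in> C ` {d..<k} then m else 0)) \<and>
     incumbent V s"

lemma record_incumbent_halts:
  assumes inv: "enum_inv 0 C V s" and X: "X = C ` {0..<k}"
    and cur: "vals s 0 = f (scaled_indicator n m X)"
    and best: "\<And>Y. Y \<in> V \<Longrightarrow> f (scaled_indicator n m Y) \<le> vals s 0"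
  shows "halts_within n m f (record_incumbent k) s (k + 3) (enum_inv 0 C (insert X V))"
proof -
  define t where
    "t = set_mem (Dir 1) (opval s (Imm 0) + opval s (Imm 0))
      (set_val (Dir 1) (vals s (addr s (Dir 0))) s)"
  have *: "enum_inv 0 C (insert X V) s'"
    if s': "vals s' = vals t"
      "mem s' = (\<lambda>a. if 5 + k \<le> a \<and> a < 5 + k + k then mem t (a - (k + 1)) else mem t a)" for s'
  proof -
    have "(\<lambda>l. mem s' (5 + k + l)) ` {..<k} = (\<lambda>l. base k + C l) ` {..<k}"
      using inv by (intro image_cong) (auto simp: s' t_def enum_inv_def)
    also have "\<dots> = (+) (base k) ` X" by (simp add: X image_image atLeast0LessThan)
    finally have best_cells: "(\<lambda>l. mem s' (5 + k + l)) ` {..<k} = (+) (base k) ` X" .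
    have v: "vals s' 1 = vals s 0" and m1: "mem s' 1 = 0" by (auto simp: s' t_def)
    have "\<forall>Y\<in>insert X V. f (scaled_indicator n m Y) \<le> vals s' 1"
      using best cur v by auto
    then have "incumbent (insert X V) s'"
      unfolding incumbent_def using best_cells v m1 cur by auto
    then show ?thesis
      using inv by (auto simp: enum_inv_def s' t_def base_def)
  qed
  have "halts_within n m f (record_incumbent k) s (1 + (1 + (k + 1))) (enum_inv 0 C (insert X V))"
    unfolding record_incumbent_def
    by (rule halts_Seq[where R = "\<lambda>s'. s' = set_val (Dir 1) (vals s (addr s (Dir 0))) s"],
        rule halts_CopyVal, rule refl,
        rule halts_Seq[where R = "\<lambda>s'. s' = t"], rule halts_Add, simp add: t_def,
        rule halts_weaken[OF save_counters_halts[OF order_refl]])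
       (auto intro!: *)
  then show ?thesis by (simp add: numeral_eq_Suc)
qed

lemma visit_halts:
  assumes inv: "enum_inv 0 C V s" and X: "X = C ` {0..<k}" "X \<subseteq> {1..n}"
  shows "halts_within n m f (visit k) s (k + 6) (enum_inv 0 C (insert X V))"
proof -
  define s1 where
    "s1 = set_val (Dir 0)
      (oracle_answer n m f (query_point n s (opval s (Imm (base k + 1))))) s"
  have "query_point n s (base k + 1) = scaled_indicator n m X"
  proof (rule eq_vecI)
    fix i assume "i < dim_vec (scaled_indicator n m X)"
    then have "i < n" by (simp add: scaled_indicator_def)
    moreover have "mem s (base k + Suc i) = (if Suc i \<in> C ` {0..<k} then m else 0)"
      using inv unfolding enum_inv_def by blast
    ultimately show "query_point n s (base k + 1) $ i = scaled_indicator n m X $ i"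
      by (simp add: query_point_def scaled_indicator_def X(1) del: atLeastLessThan_iff)
  qed (simp add: query_point_def scaled_indicator_def)
  moreover have "scaled_indicator n m X \<in> grid n m"
    by (auto simp: scaled_indicator_def grid_def)
  ultimately have cur: "vals s1 0 = f (scaled_indicator n m X)"
    by (simp add: s1_def oracle_answer_def)
  have inv1: "enum_inv 0 C V s1"
    using inv by (simp add: s1_def enum_inv_def incumbent_def)
  have "halts_within n m f (visit k) s (1 + (1 + (1 + (k + 3)))) (enum_inv 0 C (insert X V))"
    unfolding visit_def
  proof (rule halts_Seq[where R = "\<lambda>s'. s' = s1"])
    show "halts_within n m f (Query (Dir 0) (Imm (base k + 1))) s 1 (\<lambda>s'. s' = s1)"
      by (rule halts_Query) (simp add: s1_def)
    fix s' assume s': "s' = s1"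
    have rec: "halts_within n m f (record_incumbent k) s1 (k + 3) (enum_inv 0 C (insert X V))"
      if "\<And>Y. Y \<in> V \<Longrightarrow> f (scaled_indicator n m Y) \<le> vals s1 0"
      using inv1 X(1) cur that by (rule record_incumbent_halts)
    show "halts_within n m f
       (IfElse (Le (Imm 1) (At (Dir 1))) (record_incumbent k)
         (IfElse (ValLe (Dir 1) (Dir 0)) (record_incumbent k) Skip))
       s' (1 + (1 + (k + 3))) (enum_inv 0 C (insert X V))"
      unfolding s'
    proof (intro halts_IfElse)
      assume "holds s1 (Le (Imm 1) (At (Dir 1)))"
      then have "V = {}" using inv1 by (auto simp: enum_inv_def incumbent_def split: if_splits)
      then show "halts_within n m f (record_incumbent k) s1 (1 + (k + 3)) (enum_inv 0 C (insert X V))"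
        using rec by (auto intro: halts_weaken)
    next
      assume "\<not> holds s1 (Le (Imm 1) (At (Dir 1)))" and le: "holds s1 (ValLe (Dir 1) (Dir 0))"
      then have "\<forall>Y\<in>V. f (scaled_indicator n m Y) \<le> vals s1 1"
        using inv1 by (auto simp: enum_inv_def incumbent_def split: if_splits)
      then have "f (scaled_indicator n m Y) \<le> vals s1 0" if "Y \<in> V" for Y
        using that le by fastforce
      then show "halts_within n m f (record_incumbent k) s1 (k + 3) (enum_inv 0 C (insert X V))"
        by (rule rec)
    next
      assume V: "\<not> holds s1 (Le (Imm 1) (At (Dir 1)))" and le: "\<not> holds s1 (ValLe (Dir 1) (Dir 0))"
      have "V \<noteq> {}" using inv1 V by (auto simp: enum_inv_def incumbent_def)
      moreover have "f (scaled_indicator n m X) \<le> vals s1 1" using le cur by simp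
      ultimately have "incumbent (insert X V) s1"
        using inv1 unfolding enum_inv_def incumbent_def by auto
      then have "enum_inv 0 C (insert X V) s1"
        using inv1 unfolding enum_inv_def by blast
      then show "halts_within n m f Skip s1 (k + 3) (enum_inv 0 C (insert X V))"
        by (intro halts_weaken[OF halts_Skip]) auto
    qed
  qed
  then show ?thesis by (simp add: numeral_eq_Suc)
qed

lemma incumbent_cong:
  assumes "incumbent V s" "vals t 1 = vals s 1" "mem t 1 = mem s 1"
    "\<And>l. l < k \<Longrightarrow> mem t (5 + k + l) = mem s (5 + k + l)"
  shows "incumbent V t"
proof -
  have "(\<lambda>l. mem t (5 + k + l)) ` {..<k} = (\<lambda>l. mem s (5 + k + l)) ` {..<k}"
    using assms(4) by (intro image_cong) auto
  then show ?thesis using assms(1-3) by (simp add: incumbent_def)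
qed

lemma enum_inv_set_counter:
  assumes "enum_inv (Suc d) C V s" "d < k"
  shows "enum_inv (Suc d) C V (set_mem (Dir (4 + d)) v s)"
proof -
  have "incumbent V (set_mem (Dir (4 + d)) v s)"
    by (rule incumbent_cong[of V s]) (use assms in \<open>auto simp: enum_inv_def\<close>)
  then show ?thesis using assms by (auto simp: enum_inv_def base_def)
qed

lemma enum_inv_choose:
  assumes inv: "enum_inv (Suc d) C V s" and d: "d < k" and p: "mem s (4 + d) = base k + p" "0 < p"
  shows "enum_inv d (C(d := p)) V (set_mem (Ind (4 + d)) m s)"
proof -
  have "C(d := p) ` {d..<k} = insert p (C ` {Suc d..<k})"
    using d by (rule image_fun_upd_first)
  moreover have "incumbent V (set_mem (Ind (4 + d)) m s)"
    by (rule incumbent_cong[of V s]) (use inv d p in \<open>auto simp: enum_inv_def base_def\<close>)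
  ultimately show ?thesis
    using inv d p by (auto simp: enum_inv_def base_def le_Suc_eq Suc_le_eq)
qed

lemma enum_inv_unchoose:
  assumes inv: "enum_inv d (C(d := p)) V s" and d: "d < k" and p: "0 < p" "p \<notin> C ` {Suc d..<k}"
  shows "enum_inv (Suc d) C V (set_mem (Ind (4 + d)) 0 s)"
    and "mem (set_mem (Ind (4 + d)) 0 s) (4 + d) = base k + p"
proof -
  have cell: "mem s (4 + d) = base k + p" using inv d by (auto simp: enum_inv_def)
  have "C(d := p) ` {d..<k} = insert p (C ` {Suc d..<k})"
    using d by (rule image_fun_upd_first)
  moreover have "incumbent V (set_mem (Ind (4 + d)) 0 s)"
    by (rule incumbent_cong[of V s]) (use inv d p cell in \<open>auto simp: enum_inv_def base_def\<close>)
  ultimately show "enum_inv (Suc d) C V (set_mem (Ind (4 + d)) 0 s)"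
    using inv d p cell by (auto simp: enum_inv_def base_def)
  show "mem (set_mem (Ind (4 + d)) 0 s) (4 + d) = base k + p"
    using cell d p by (auto simp: base_def)
qed

primrec enum_time :: "nat \<Rightarrow> nat" where
  "enum_time 0 = k + 6"
| "enum_time (Suc d) = 1 + (n * (1 + (1 + (enum_time d + (1 + 1)))) + 1)"

text \<open>No position chosen so far exceeds \<open>C d\<close>, so every position tried next is new, and resetting
  its entry to zero afterwards restores the query point.\<close>

lemma enumerate_halts:
  assumes "d \<le> k" "C ` {d..<k} \<subseteq> {1..C d}" "C d \<le> n" "enum_inv d C V s"
  shows "halts_within n m f (enumerate k d) s (enum_time d)
    (enum_inv d C (V \<union> extensions n d (C d) (C ` {d..<k})))"
  using assms
proof (induction d arbitrary: C V s)
  case 0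
  have "C ` {0..<k} \<subseteq> {1..n}"
    using 0(2) by (rule order_trans) (use 0(3) in auto)
  from visit_halts[OF 0(4) refl this] show ?case by simp
next
  case (Suc d)
  define S where "S = C ` {Suc d..<k}"
  define q where "q = C (Suc d)"
  have d: "d < k" using Suc.prems(1) by simp
  have S: "S \<subseteq> {1..q}" and q: "q \<le> n" using Suc.prems by (auto simp: S_def q_def)
  \<comment> \<open>the sets visited before the counter of this loop reaches \<open>p\<close>\<close>
  define W where "W p = V \<union> (\<Union>r\<in>{q<..<p}. extensions n d r (insert r S))" for p
  define I where "I i s \<longleftrightarrow> mem s (4 + d) = base k + (q + 1 + i) \<and>
      enum_inv (Suc d) C (W (q + 1 + i)) s" for i s
  have halts: "halts_within n m f (enumerate k (Suc d)) s
    (1 + ((n - q) * (1 + (1 + (enum_time d + (1 + 1)))) + 1)) (I (n - q))"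
    unfolding enumerate.simps
  proof (rule halts_Seq[where R = "I 0"])
    have "{q<..<Suc q} = {}" by auto
    then have "W (Suc q) = V" by (simp add: W_def)
    moreover have "mem s (4 + Suc d) = base k + q"
      using Suc.prems(1,4) unfolding enum_inv_def q_def by blast
    then have "mem s (5 + d) = base k + q" by simp
    ultimately show "halts_within n m f (Add (Dir (4 + d)) (At (Dir (5 + d))) (Imm 1)) s 1 (I 0)"
      using enum_inv_set_counter[OF Suc.prems(4) d]
      by (intro halts_Add) (simp add: I_def)
    fix s' assume "I 0 s'"
    then show "halts_within n m f (While (Le (At (Dir (4 + d))) (At (Dir 3)))
         (Seq (Add (Ind (4 + d)) (At (Dir 2)) (Imm 0))
         (Seq (enumerate k d)
         (Seq (Add (Ind (4 + d)) (Imm 0) (Imm 0))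
              (Add (Dir (4 + d)) (At (Dir (4 + d))) (Imm 1))))))
       s' ((n - q) * (1 + (1 + (enum_time d + (1 + 1)))) + 1) (I (n - q))"
    proof (rule halts_While)
      fix i s assume i: "i < n - q" and I: "I i s"
      then show "holds s (Le (At (Dir (4 + d))) (At (Dir 3)))"
        by (simp add: I_def enum_inv_def)
      define p where "p = q + 1 + i"
      have p: "q < p" "p \<le> n" using i by (auto simp: p_def)
      have pS: "p \<notin> S" using S p by auto
      have upd: "C(d := p) ` {d..<k} = insert p S"
        unfolding S_def using d by (rule image_fun_upd_first)
      have inv: "enum_inv (Suc d) C (W p) s" and cnt: "mem s (4 + d) = base k + p"
        using I by (auto simp: I_def p_def)
      show "halts_within n m f
         (Seq (Add (Ind (4 + d)) (At (Dir 2)) (Imm 0))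
         (Seq (enumerate k d)
         (Seq (Add (Ind (4 + d)) (Imm 0) (Imm 0))
              (Add (Dir (4 + d)) (At (Dir (4 + d))) (Imm 1)))))
         s (1 + (enum_time d + (1 + 1))) (I (Suc i))"
      proof (rule halts_Seq[where R = "enum_inv d (C(d := p)) (W p)"])
        show "halts_within n m f (Add (Ind (4 + d)) (At (Dir 2)) (Imm 0)) s 1
            (enum_inv d (C(d := p)) (W p))"
          using enum_inv_choose[OF inv d cnt] p inv
          by (intro halts_Add) (simp add: enum_inv_def)
        fix s1 assume s1: "enum_inv d (C(d := p)) (W p) s1"
        have upper: "(C(d := p)) d = p" by simp
        have "C(d := p) ` {d..<k} \<subseteq> {1..(C(d := p)) d}"
          unfolding upd upper using S p by auto
        from Suc.IH[OF less_imp_le[OF d] this _ s1]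
        have rec: "halts_within n m f (enumerate k d) s1 (enum_time d)
            (enum_inv d (C(d := p)) (W p \<union> extensions n d p (insert p S)))"
          unfolding upd upper using p by blast
        have "{q<..<Suc p} = insert p {q<..<p}" using p by auto
        then have W: "W p \<union> extensions n d p (insert p S) = W (Suc p)" by (auto simp: W_def)
        show "halts_within n m f
           (Seq (enumerate k d)
           (Seq (Add (Ind (4 + d)) (Imm 0) (Imm 0))
                (Add (Dir (4 + d)) (At (Dir (4 + d))) (Imm 1))))
           s1 (enum_time d + (1 + 1)) (I (Suc i))"
        proof (rule halts_Seq[OF rec], rule halts_Seq)
          fix s2 assume s2: "enum_inv d (C(d := p)) (W p \<union> extensions n d p (insert p S)) s2"
          show "halts_within n m f (Add (Ind (4 + d)) (Imm 0) (Imm 0)) s2 1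
              (\<lambda>s3. enum_inv (Suc d) C (W (Suc p)) s3 \<and> mem s3 (4 + d) = base k + p)"
            using enum_inv_unchoose[OF s2[unfolded W] d _ pS[unfolded S_def]] p
            by (intro halts_Add) simp
        next
          fix s3 assume "enum_inv (Suc d) C (W (Suc p)) s3 \<and> mem s3 (4 + d) = base k + p"
          then show "halts_within n m f (Add (Dir (4 + d)) (At (Dir (4 + d))) (Imm 1)) s3 1
              (I (Suc i))"
            using enum_inv_set_counter[OF _ d]
            by (intro halts_Add) (simp add: I_def p_def)
        qed
      qed
    next
      fix s assume "I (n - q) s"
      then show "\<not> holds s (Le (At (Dir (4 + d))) (At (Dir 3)))"
        using q by (simp add: I_def enum_inv_def)
    qed
  qed
  have "{q<..<q + 1 + (n - q)} = {q<..n}" using q by auto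
  then have "W (q + 1 + (n - q)) = V \<union> extensions n (Suc d) q S"
    by (simp add: W_def extensions_Suc)
  then have "enum_inv (Suc d) C (V \<union> extensions n (Suc d) q S) s'" if "I (n - q) s'" for s'
    using that by (simp add: I_def)
  moreover have "1 + ((n - q) * (1 + (1 + (enum_time d + (1 + 1)))) + 1) \<le> enum_time (Suc d)"
    unfolding enum_time.simps by (intro add_mono mult_le_mono1 order_refl diff_le_self)
  ultimately show ?case
    using halts unfolding S_def q_def by (blast intro: halts_weaken)
qed

end

text \<open>All addresses written to exceed \<open>base k\<close>, so writing entries never changes the recorded
  counters or \<open>n\<close>.\<close>

lemma write_column_halts:
  fixes s :: state
  assumes "l \<le> k" and addr: "\<And>i. i < k \<Longrightarrow> base k < mem s (5 + k + i)"
  shows "halts_within n m f (write_column k l) s (2 * l + 1)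
    (\<lambda>s'. mem s' = (\<lambda>a. if a \<in> (\<lambda>i. mem s (5 + k + i) + mem s 0) ` {..<l} then 1
        else if 5 + k \<le> a \<and> a < 5 + k + l then mem s a + mem s 0 else mem s a))"
  using assms(1)
proof (induction l)
  case 0
  have "halts_within n m f Skip s 1 (\<lambda>s'. s' = s)" by (rule halts_Skip) simp
  then show ?case unfolding write_column.simps by (rule halts_weaken) auto
next
  case (Suc l)
  let ?b = "5 + k + l"
  define written where "written = (\<lambda>i. mem s (5 + k + i) + mem s 0) ` {..<l}"
  have low: "a \<notin> written" if "a \<le> base k" for a
  proof
    assume "a \<in> written"
    then obtain i where "i < l" "a = mem s (5 + k + i) + mem s 0" by (auto simp: written_def)
    with addr[of i] that Suc.prems show False by simp
  qed
  have b: "?b \<le> base k" "base k < mem s ?b"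
    using Suc.prems addr[of l] by (auto simp: base_def)
  have img: "(\<lambda>i. mem s (5 + k + i) + mem s 0) ` {..<Suc l} = insert (mem s ?b + mem s 0) written"
    by (simp add: written_def lessThan_Suc)
  have "halts_within n m f (write_column k (Suc l)) s (2 * l + 1 + (1 + 1))
    (\<lambda>s'. mem s' = (\<lambda>a. if a \<in> insert (mem s ?b + mem s 0) written then 1
        else if 5 + k \<le> a \<and> a < 5 + k + Suc l then mem s a + mem s 0 else mem s a))"
    unfolding write_column.simps
  proof (rule halts_Seq[OF Suc.IH])
    show "l \<le> k" using Suc.prems by simp
    fix s1 :: state
    assume "mem s1 = (\<lambda>a. if a \<in> (\<lambda>i. mem s (5 + k + i) + mem s 0) ` {..<l} then 1
        else if 5 + k \<le> a \<and> a < 5 + k + l then mem s a + mem s 0 else mem s a)"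
    then have s1: "mem s1 = (\<lambda>a. if a \<in> written then 1
        else if 5 + k \<le> a \<and> a < 5 + k + l then mem s a + mem s 0 else mem s a)"
      by (simp only: written_def)
    have s1_b: "mem s1 ?b = mem s ?b" and s1_0: "mem s1 0 = mem s 0"
      using low[of ?b] low[of 0] b by (simp_all add: s1)
    define s2 where "s2 = set_mem (Dir ?b) (mem s ?b + mem s 0) s1"
    have s2_b: "mem s2 ?b = mem s ?b + mem s 0" by (simp add: s2_def)
    show "halts_within n m f
        (Seq (Add (Dir ?b) (At (Dir ?b)) (At (Dir 0))) (Add (Ind ?b) (Imm 1) (Imm 0))) s1 (1 + 1)
        (\<lambda>s'. mem s' = (\<lambda>a. if a \<in> insert (mem s ?b + mem s 0) written then 1
          else if 5 + k \<le> a \<and> a < 5 + k + Suc l then mem s a + mem s 0 else mem s a))"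
    proof (rule halts_Seq[where R = "\<lambda>s'. s' = s2"])
      show "halts_within n m f (Add (Dir ?b) (At (Dir ?b)) (At (Dir 0))) s1 1 (\<lambda>s'. s' = s2)"
        by (rule halts_Add) (simp add: s2_def s1_b s1_0)
      fix s' assume s': "s' = s2"
      have "mem (set_mem (Ind ?b) 1 s2) = (mem s1)(?b := mem s ?b + mem s 0, mem s ?b + mem s 0 := 1)"
        using s2_b by (simp add: s2_def)
      also have "\<dots> = (\<lambda>a. if a \<in> insert (mem s ?b + mem s 0) written then 1
          else if 5 + k \<le> a \<and> a < 5 + k + Suc l then mem s a + mem s 0 else mem s a)"
        using low[OF b(1)] by (auto simp: s1 fun_eq_iff)
      finally show "halts_within n m f (Add (Ind ?b) (Imm 1) (Imm 0)) s' 1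
          (\<lambda>s'. mem s' = (\<lambda>a. if a \<in> insert (mem s ?b + mem s 0) written then 1
            else if 5 + k \<le> a \<and> a < 5 + k + Suc l then mem s a + mem s 0 else mem s a))"
        unfolding s' by (intro halts_Add) simp
    qed
  qed
  then show ?case unfolding img by (rule halts_weaken) auto
qed

lemma write_output_halts:
  fixes s :: state
  assumes size: "mem s 0 = n" "mem s 2 = m"
    and zero: "\<And>a. base k + n < a \<Longrightarrow> mem s a = 0"
    and cells: "(\<lambda>l. mem s (5 + k + l)) ` {..<k} = (+) (base k) ` X" and X: "X \<subseteq> {1..n}"
  shows "halts_within n m f (write_output k) s (m * (2 * k + 3) + 2)
    (\<lambda>s'. output_matrix n m s' = mat_of_cols n (replicate m (scaled_indicator n 1 X)))"
proof -
  define \<alpha> where "\<alpha> l = mem s (5 + k + l)" for l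
  have \<alpha>_img: "\<alpha> ` {..<k} = (+) (base k) ` X" using cells by (simp add: \<alpha>_def)
  have \<alpha>: "base k < \<alpha> l" if "l < k" for l
  proof -
    have "\<alpha> l \<in> (+) (base k) ` X" using that \<alpha>_img by blast
    then show ?thesis using X by force
  qed
  define I where "I j s' \<longleftrightarrow> mem s' 0 = n \<and> mem s' 2 = m - j \<and>
      (\<forall>l<k. mem s' (5 + k + l) = \<alpha> l + j * n) \<and>
      (\<forall>a>base k + n. mem s' a = (if \<exists>i<j. a \<in> (\<lambda>l. \<alpha> l + Suc i * n) ` {..<k} then 1 else 0))"
    for j and s' :: state
  have "halts_within n m f (write_output k) s (m * (1 + (2 * k + 1 + 1)) + 1 + 1)
    (\<lambda>s'. output_matrix n m s' = mat_of_cols n (replicate m (scaled_indicator n 1 X)))"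
    unfolding write_output_def
  proof (rule halts_Seq[where R = "I m"], rule halts_While[where I = I])
    show "I 0 s" using size zero by (simp add: I_def \<alpha>_def)
  next
    fix j and s1 :: state assume j: "j < m" and I: "I j s1"
    then show "holds s1 (Le (Imm 1) (At (Dir 2)))" by (simp add: I_def)
    have addr1: "base k < mem s1 (5 + k + i)" if "i < k" for i
      using I \<alpha>[OF that] that by (simp add: I_def)
    have new: "(\<lambda>i. mem s1 (5 + k + i) + mem s1 0) ` {..<k} = (\<lambda>l. \<alpha> l + Suc j * n) ` {..<k}"
      using I by (intro image_cong) (auto simp: I_def)
    have new_low: "a \<notin> (\<lambda>l. \<alpha> l + Suc j * n) ` {..<k}" if "a \<le> base k" for a
      using \<alpha> that by fastforce
    show "halts_within n m f (Seq (write_column k k) (Sub (Dir 2) (At (Dir 2)) (Imm 1))) s1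
        (2 * k + 1 + 1) (I (Suc j))"
    proof (rule halts_Seq[OF write_column_halts[OF order_refl addr1]])
      fix s2 :: state
      assume "mem s2 = (\<lambda>a. if a \<in> (\<lambda>i. mem s1 (5 + k + i) + mem s1 0) ` {..<k} then 1
          else if 5 + k \<le> a \<and> a < 5 + k + k then mem s1 a + mem s1 0 else mem s1 a)"
      then have s2: "mem s2 = (\<lambda>a. if a \<in> (\<lambda>l. \<alpha> l + Suc j * n) ` {..<k} then 1
          else if 5 + k \<le> a \<and> a < 5 + k + k then mem s1 a + mem s1 0 else mem s1 a)"
        unfolding new .
      let ?s3 = "set_mem (Dir 2) (mem s2 2 - 1) s2"
      have "mem ?s3 0 = n" "mem ?s3 2 = m - Suc j"
        using I new_low[of 0] new_low[of 2] by (auto simp: I_def s2 base_def)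
      moreover have "mem ?s3 (5 + k + l) = \<alpha> l + Suc j * n" if "l < k" for l
        using I new_low[of "5 + k + l"] that by (auto simp: I_def s2 base_def)
      moreover have "mem ?s3 a = (if \<exists>i<Suc j. a \<in> (\<lambda>l. \<alpha> l + Suc i * n) ` {..<k} then 1 else 0)"
        if "base k + n < a" for a
      proof -
        have "mem ?s3 a = mem s2 a" using that by (simp add: base_def)
        also have "\<dots> = (if a \<in> (\<lambda>l. \<alpha> l + Suc j * n) ` {..<k} then 1 else mem s1 a)"
          using that by (simp add: s2 base_def)
        also have "mem s1 a = (if \<exists>i<j. a \<in> (\<lambda>l. \<alpha> l + Suc i * n) ` {..<k} then 1 else 0)"
          using I that unfolding I_def by blast
        finally show ?thesis by (simp only: less_Suc_eq) (metis (no_types, lifting))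
      qed
      ultimately have "I (Suc j) ?s3" unfolding I_def by blast
      then show "halts_within n m f (Sub (Dir 2) (At (Dir 2)) (Imm 1)) s2 1 (I (Suc j))"
        by (intro halts_Sub) simp
    qed
  next
    fix s' :: state assume "I m s'"
    then show "\<not> holds s' (Le (Imm 1) (At (Dir 2)))" by (simp add: I_def)
  next
    fix s' :: state assume I: "I m s'"
    let ?s = "set_mem (Dir 0) (mem s' 0 + (base k + 1)) s'"
    have "mem ?s (mem ?s 0 + j * n + i) = (if Suc i \<in> X then 1 else 0)" if "i < n" "j < m" for i j
    proof -
      have "(\<exists>j'<m. mem ?s 0 + j * n + i \<in> (\<lambda>l. \<alpha> l + Suc j' * n) ` {..<k})
          \<longleftrightarrow> (\<exists>j'<m. \<exists>x\<in>X. j * n + Suc i = j' * n + x)"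
      proof -
        have "(\<lambda>l. \<alpha> l + Suc j' * n) ` {..<k} = (\<lambda>x. base k + x + Suc j' * n) ` X" for j'
        proof -
          have "(\<lambda>l. \<alpha> l + Suc j' * n) ` {..<k} = (\<lambda>x. x + Suc j' * n) ` \<alpha> ` {..<k}"
            by (simp only: image_image)
          then show ?thesis unfolding \<alpha>_img by (simp only: image_image)
        qed
        moreover have "mem ?s 0 = n + (base k + 1)" using I by (simp add: I_def)
        ultimately show ?thesis by (auto simp: image_iff)
      qed
      also have "\<dots> \<longleftrightarrow> Suc i \<in> X"
      proof
        assume "\<exists>j'<m. \<exists>x\<in>X. j * n + Suc i = j' * n + x"
        then obtain j' x where x: "x \<in> X" "j * n + Suc i = j' * n + x" by blast
        moreover obtain y where y: "x = Suc y" "y < n" using x(1) X by (cases x) auto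
        ultimately have "j * n + i = j' * n + y" by simp
        \<comment> \<open>two entries share a cell only if their row numbers agree, as both are less than \<open>n\<close>\<close>
        then have "(j * n + i) mod n = (j' * n + y) mod n" by simp
        then have "i = y" using that(1) y(2) by simp
        then show "Suc i \<in> X" using x(1) y(1) by simp
      qed (use that(2) in blast)
      finally have "(\<exists>j'<m. mem ?s 0 + j * n + i \<in> (\<lambda>l. \<alpha> l + Suc j' * n) ` {..<k}) \<longleftrightarrow> Suc i \<in> X" .
      moreover have "base k + n < mem ?s 0 + j * n + i" "mem ?s 0 + j * n + i \<noteq> 0"
        using I by (auto simp: I_def)
      ultimately show ?thesis using I by (simp add: I_def)
    qed
    then have "output_matrix n m ?s = mat_of_cols n (replicate m (scaled_indicator n 1 X))"
      by (intro eq_matI) (auto simp: output_matrix_def mat_of_cols_index scaled_indicator_def)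
    then show "halts_within n m f (Add (Dir 0) (At (Dir 0)) (Imm (base k + 1))) s' 1
      (\<lambda>s'. output_matrix n m s' = mat_of_cols n (replicate m (scaled_indicator n 1 X)))"
      by (intro halts_Add) simp
  qed
  then show ?thesis by (rule halts_weaken) (auto simp: algebra_simps)
qed

text \<open>The enumeration compares \<open>f (m \<cdot>\<^sub>v x)\<close> over the whole cube layer, and repeating the winner
  \<open>m\<close> times is optimal by the averaging argument.\<close>

lemma solver_correct:
  assumes adm: "admissible n k m f"
  shows "\<exists>t. solves_in (solver k) n k m f t \<and> t \<le> enum_time n k k + m * (2 * k + 3) + 4"
proof -
  let ?s0 = "initial_state n k m"
  have k: "1 \<le> k" "k \<le> n" and m: "1 \<le> m" and conv: "convex_on_grid n m f"
    using adm by (auto simp: admissible_def)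
  define s1 where "s1 = set_mem (Dir 3) (n + base k) ?s0"
  define s2 where "s2 = set_mem (Dir (4 + k)) (base k) s1"
  have s2: "mem s2 = (\<lambda>_. 0)(0 := n, 1 := k, 2 := m, 3 := n + base k, 4 + k := base k)"
    by (simp add: s2_def s1_def initial_state_def)
  have "enum_inv n m k f k (\<lambda>_. 0) {} s2"
    using k(1) by (auto simp: enum_inv_def incumbent_def s2 base_def)
  then have enum: "halts_within n m f (enumerate k k) s2 (enum_time n k k)
      (enum_inv n m k f k (\<lambda>_. 0) (positions n k))"
    using enumerate_halts[of k k "\<lambda>_. 0" n m f "{}" s2] by (simp add: extensions_empty)
  have ne: "positions n k \<noteq> {}"
  proof -
    have "{1..k} \<in> positions n k" using k by (simp add: positions_def)
    then show ?thesis by blast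
  qed
  have "halts_within n m f (solver k) ?s0 (1 + (1 + (enum_time n k k + (m * (2 * k + 3) + 2))))
      (\<lambda>s. optimal n k m f (output_matrix n m s))"
    unfolding solver_def
  proof (rule halts_Seq[where R = "\<lambda>s. s = s1"])
    show "halts_within n m f (Add (Dir 3) (At (Dir 0)) (Imm (base k))) ?s0 1 (\<lambda>s. s = s1)"
      by (rule halts_Add) (simp add: s1_def initial_state_def)
    fix s assume s: "s = s1"
    show "halts_within n m f
        (Seq (Add (Dir (4 + k)) (Imm (base k)) (Imm 0)) (Seq (enumerate k k) (write_output k)))
        s (1 + (enum_time n k k + (m * (2 * k + 3) + 2)))
        (\<lambda>s. optimal n k m f (output_matrix n m s))"
      unfolding s
    proof (rule halts_Seq[where R = "\<lambda>s. s = s2"])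
      show "halts_within n m f (Add (Dir (4 + k)) (Imm (base k)) (Imm 0)) s1 1 (\<lambda>s. s = s2)"
        by (rule halts_Add) (simp add: s2_def)
      fix s assume s: "s = s2"
      show "halts_within n m f (Seq (enumerate k k) (write_output k)) s
        (enum_time n k k + (m * (2 * k + 3) + 2)) (\<lambda>s. optimal n k m f (output_matrix n m s))"
        unfolding s
      proof (rule halts_Seq[OF enum])
        fix s assume inv: "enum_inv n m k f k (\<lambda>_. 0) (positions n k) s"
        then obtain X where X: "X \<in> positions n k" "vals s 1 = f (scaled_indicator n m X)"
            "(\<lambda>l. mem s (5 + k + l)) ` {..<k} = (+) (base k) ` X"
            "\<forall>Y\<in>positions n k. f (scaled_indicator n m Y) \<le> vals s 1"
          using ne unfolding enum_inv_def incumbent_def by blast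
        have "is_arg_max (\<lambda>x. f (m \<cdot>\<^sub>v x)) (\<lambda>x. x \<in> cube_layer n k) (scaled_indicator n 1 X)"
          using X by (auto simp: is_arg_max_linorder cube_layer_eq_image)
        then have opt: "optimal n k m f (mat_of_cols n (replicate m (scaled_indicator n 1 X)))"
          by (rule optimal_replicate[OF conv m])
        have "mem s a = 0" if "base k + n < a" for a
        proof -
          have "\<forall>p>0. mem s (base k + p) = 0"
            using inv unfolding enum_inv_def by simp
          then show ?thesis using that by (auto dest!: spec[of _ "a - base k"])
        qed
        then have "halts_within n m f (write_output k) s (m * (2 * k + 3) + 2)
            (\<lambda>s'. output_matrix n m s' = mat_of_cols n (replicate m (scaled_indicator n 1 X)))"
          using inv X by (intro write_output_halts) (auto simp: enum_inv_def positions_def)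
        then show "halts_within n m f (write_output k) s (m * (2 * k + 3) + 2)
            (\<lambda>s. optimal n k m f (output_matrix n m s))"
          by (rule halts_weaken) (simp_all add: opt del: One_nat_def)
      qed
    qed
  qed
  then show ?thesis unfolding halts_within_def solves_in_def by fastforce
qed

text \<open>Each of the \<open>d\<close> loops multiplies the time by at most \<open>N\<close> and adds a constant amount of
  work per round, which the summand \<open>6 * d\<close> in the coefficient absorbs.\<close>

lemma enum_time_le:
  assumes "1 \<le> N" "n \<le> N"
  shows "enum_time n k d \<le> (k + 6 + 6 * d) * N ^ d"
proof (induction d)
  case (Suc d)
  have N: "1 \<le> N ^ d" using assms by simp
  have "enum_time n k (Suc d) = 2 + n * (4 + enum_time n k d)" by (simp add: algebra_simps)
  also have "\<dots> \<le> 2 * N ^ Suc d + N * (4 * N ^ d + (k + 6 + 6 * d) * N ^ d)"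
    using Suc assms N by (intro add_mono mult_mono) (auto simp: one_le_power)
  also have "\<dots> = (k + 6 + 6 * Suc d) * N ^ Suc d" by (simp add: algebra_simps)
  finally show ?case .
qed simp

lemma solver_polynomial:
  assumes "admissible n k m f"
  shows "\<exists>t. solves_in (solver k) n k m f t \<and> t \<le> (9 * k + 13) * (n + m) ^ k"
proof -
  have k: "1 \<le> k" and N: "1 \<le> n + m" using assms by (auto simp: admissible_def)
  then have pow: "n + m \<le> (n + m) ^ k" "1 \<le> (n + m) ^ k"
    using self_le_power[of "n + m" k] by auto
  have "enum_time n k k \<le> (k + 6 + 6 * k) * (n + m) ^ k"
    using N by (intro enum_time_le) auto
  moreover have "m * (2 * k + 3) \<le> (2 * k + 3) * (n + m) ^ k"
    using pow(1) by (subst mult.commute, intro mult_le_mono2) simp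
  moreover have "4 \<le> 4 * (n + m) ^ k" using pow(2) by simp
  ultimately have "enum_time n k k + m * (2 * k + 3) + 4 \<le>
      (k + 6 + 6 * k) * (n + m) ^ k + (2 * k + 3) * (n + m) ^ k + 4 * (n + m) ^ k"
    by (intro add_mono)
  also have "\<dots> = (9 * k + 13) * (n + m) ^ k" by (simp add: algebra_simps)
  finally show ?thesis using solver_correct[OF assms] order_trans by blast
qed

section \<open>Adversary argument for unbounded edge size\<close>

lemma convex_on_grid_zero: "convex_on_grid n m (\<lambda>_. 0)"
  unfolding convex_on_grid_def convex_fun_def by (intro exI[of _ "\<lambda>_. 0"]) auto

text \<open>On the vertices of the cube the indicator function of the vertex \<open>p\<close> coincides with the convex
  function \<open>max 0 (1 - h x)\<close>, where \<open>h\<close> is the affine function that equals the Hamming distance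
  from \<open>p\<close> on the vertices.\<close>

lemma convex_on_grid_delta:
  assumes p: "p \<in> grid n 1"
  shows "convex_on_grid n 1 (\<lambda>z. if z = p then 1 else 0)"
proof -
  define h where "h x = (\<Sum>i<n. if p $ i = 1 then 1 - x $ i else x $ i)" for x :: "real vec"
  define g where "g x = max 0 (1 - h x)" for x
  have h: "h (t \<cdot>\<^sub>v x + (1 - t) \<cdot>\<^sub>v y) = t * h x + (1 - t) * h y"
    if "x \<in> carrier_vec n" "y \<in> carrier_vec n" for x y t
    unfolding h_def sum_distrib_left sum.distrib[symmetric] using that
    by (intro sum.cong refl) (simp add: algebra_simps)
  have "convex_fun n g"
    unfolding convex_fun_def
  proof (intro ballI allI impI)
    fix x y :: "real vec" and t :: real
    assume xy: "x \<in> carrier_vec n" "y \<in> carrier_vec n" and t: "0 \<le> t \<and> t \<le> 1"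
    have "t * (1 - h x) + (1 - t) * (1 - h y) \<le> t * g x + (1 - t) * g y"
      using t by (intro add_mono mult_left_mono) (auto simp: g_def)
    moreover have "0 \<le> t * g x + (1 - t) * g y"
      using t by (auto simp: g_def)
    ultimately show "g (t \<cdot>\<^sub>v x + (1 - t) \<cdot>\<^sub>v y) \<le> t * g x + (1 - t) * g y"
      unfolding g_def[of "t \<cdot>\<^sub>v x + (1 - t) \<cdot>\<^sub>v y"] h[OF xy] by (simp add: algebra_simps)
  qed
  moreover have "(if z = p then 1 else 0) = g (map_vec real z)" if z: "z \<in> grid n 1" for z
  proof -
    have zp: "z \<in> carrier_vec n" "p \<in> carrier_vec n"
      and z01: "\<And>i. i < n \<Longrightarrow> z $ i = 0 \<or> z $ i = 1" and p01: "\<And>i. i < n \<Longrightarrow> p $ i = 0 \<or> p $ i = 1"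
      using z p by (auto simp: grid_def le_Suc_eq)
    have h_eq: "h (map_vec real z) = (\<Sum>i<n. if z $ i = p $ i then 0 else 1)"
      unfolding h_def
    proof (intro sum.cong refl)
      fix i assume "i \<in> {..<n}"
      then show "(if p $ i = 1 then 1 - map_vec real z $ i else map_vec real z $ i)
          = (if z $ i = p $ i then 0 else 1)"
        using z01[of i] p01[of i] zp by auto
    qed
    show ?thesis
    proof (cases "z = p")
      case True
      then have "h (map_vec real z) = 0" unfolding h_eq by simp
      then show ?thesis using True by (simp add: g_def)
    next
      case False
      then obtain i where i: "i < n" "z $ i \<noteq> p $ i" using zp by (auto simp: vec_eq_iff)
      have "(1::real) \<le> (\<Sum>i<n. if z $ i = p $ i then 0 else 1)"
        using member_le_sum[of i "{..<n}" "\<lambda>i. if z $ i = p $ i then 0 else (1::real)"] i by auto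
      then have "1 \<le> h (map_vec real z)" unfolding h_eq .
      then show ?thesis using False by (simp add: g_def)
    qed
  qed
  ultimately show ?thesis unfolding convex_on_grid_def by blast
qed

text \<open>Every oracle query takes one time unit, and the oracle influences a run only by its
  answers.\<close>

lemma run_determined_by_few_queries:
  assumes "exec n m f P s t s'"
  obtains Q where "finite Q" "card Q \<le> t"
    "\<And>f'. (\<And>z. z \<in> Q \<Longrightarrow> f' z = f z) \<Longrightarrow> exec n m f' P s t s'"
proof -
  define known where "known P s t s' Q \<longleftrightarrow> finite Q \<and> card Q \<le> t \<and>
      (\<forall>f'. (\<forall>z\<in>Q. f' z = f z) \<longrightarrow> exec n m f' P s t s')" for P s t s' and Q :: "nat vec set"
  have "\<exists>Q. known P s t s' Q"
    using assms
  proof (induction rule: exec.induct)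
    case (Skip s)
    show ?case unfolding known_def by (intro exI[of _ "{}"] conjI allI impI exec.Skip) auto
  next
    case (Add l a b s)
    show ?case unfolding known_def by (intro exI[of _ "{}"] conjI allI impI exec.Add) auto
  next
    case (Sub l a b s)
    show ?case unfolding known_def by (intro exI[of _ "{}"] conjI allI impI exec.Sub) auto
  next
    case (CopyVal l l' s)
    show ?case unfolding known_def by (intro exI[of _ "{}"] conjI allI impI exec.CopyVal) auto
  next
    case (Query l a s)
    let ?z = "query_point n s (opval s a)"
    have "exec n m f' (Query l a) s 1 (set_val l (oracle_answer n m f ?z) s)"
      if "f' ?z = f ?z" for f'
    proof -
      have "oracle_answer n m f ?z = oracle_answer n m f' ?z"
        using that by (simp add: oracle_answer_def)
      then show ?thesis by (simp only: exec.Query)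
    qed
    then show ?case unfolding known_def by (intro exI[of _ "{?z}"]) auto
  next
    case (Seq P s t s' Q t' s'')
    then obtain A B where "known P s t s' A" "known Q s' t' s'' B" by blast
    then have "known (Seq P Q) s (t + t') s'' (A \<union> B)"
      unfolding known_def using card_Un_le[of A B]
      by (blast intro: exec.Seq finite_UnI order_trans add_mono)
    then show ?case ..
  next
    case (IfTrue s b P t s' Q)
    then obtain A where "known P s t s' A" by blast
    then have "known (IfElse b P Q) s (1 + t) s' A"
      unfolding known_def using exec.IfTrue[OF IfTrue.hyps(1)] trans_le_add2 by blast
    then show ?case ..
  next
    case (IfFalse s b Q t s' P)
    then obtain A where "known Q s t s' A" by blast
    then have "known (IfElse b P Q) s (1 + t) s' A"
      unfolding known_def using exec.IfFalse[OF IfFalse.hyps(1)] trans_le_add2 by blast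
    then show ?case ..
  next
    case (WhileFalse s b P)
    then show ?case
      unfolding known_def by (intro exI[of _ "{}"] conjI allI impI exec.WhileFalse) auto
  next
    case (WhileTrue s b P t s' t' s'')
    then obtain A B where A: "known P s t s' A" and B: "known (While b P) s' t' s'' B" by blast
    have "card (A \<union> B) \<le> 1 + t + t'"
      using card_Un_le[of A B] A B unfolding known_def by linarith
    moreover have "exec n m f' (While b P) s (1 + t + t') s''"
      if "\<forall>z\<in>A \<union> B. f' z = f z" for f'
      using exec.WhileTrue[OF WhileTrue.hyps(1)] A B that unfolding known_def by blast
    ultimately have "known (While b P) s (1 + t + t') s'' (A \<union> B)"
      using A B unfolding known_def by blast
    then show ?case ..
  qed
  then obtain Q where Q: "known P s t s' Q" by blast
  show thesis
  proof (rule that[of Q])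
    fix f' assume "\<And>z. z \<in> Q \<Longrightarrow> f' z = f z"
    then show "exec n m f' P s t s'" using Q unfolding known_def by simp
  qed (use Q in \<open>simp_all add: known_def\<close>)
qed

text \<open>If a run with the zero function leaves two points of the cube layer unqueried, then one of
  them, \<open>p\<close>, is not the output either.  Raising the function at \<open>p\<close> to 1 does not change the
  run, whose output now fails to be optimal.\<close>

lemma binomial_le_solver_time:
  assumes P: "\<And>f. admissible n k 1 f \<Longrightarrow> \<exists>t. solves_in P n k 1 f t"
    and k: "1 \<le> k" "k \<le> n" and t: "solves_in P n k 1 (\<lambda>_. 0) t"
  shows "n choose k \<le> t + 1"
proof (rule ccontr)
  assume "\<not> n choose k \<le> t + 1"
  then have big: "t + 1 < card (cube_layer n k)" by (simp add: card_cube_layer)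
  obtain s where s: "exec n 1 (\<lambda>_. 0) P (initial_state n k 1) t s"
    using t by (auto simp: solves_in_def)
  obtain Q where Q: "finite Q" "card Q \<le> t"
    "\<And>f'. (\<And>z. z \<in> Q \<Longrightarrow> f' z = 0) \<Longrightarrow> exec n 1 f' P (initial_state n k 1) t s"
    using run_determined_by_few_queries[OF s] by blast
  define x where "x = degree_seq (output_matrix n 1 s)"
  have "card (insert x Q) < card (cube_layer n k)"
    using big Q(2) card_insert_le_m1[of "t + 1" Q x] by simp
  then obtain p where p: "p \<in> cube_layer n k" "p \<notin> Q" "p \<noteq> x"
    using card_mono[of "insert x Q" "cube_layer n k"] Q(1) by fastforce
  define f :: "nat vec \<Rightarrow> real" where "f = (\<lambda>z. if z = p then 1 else 0)"
  have "p \<in> grid n 1"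
    using smult_cube_layer_in_grid[OF p(1), of 1] p(1) by (auto simp: cube_layer_def grid_def)
  then have "admissible n k 1 f"
    using k convex_on_grid_delta by (simp add: admissible_def f_def)
  then obtain t' s' where s': "exec n 1 f P (initial_state n k 1) t' s'"
      "optimal n k 1 f (output_matrix n 1 s')"
    using P unfolding solves_in_def by blast
  have "exec n 1 f P (initial_state n k 1) t s"
    by (rule Q(3)) (use p(2) in \<open>auto simp: f_def\<close>)
  then have "s' = s" using exec_deterministic s'(1) by blast
  then have "f (degree_seq (mat_of_cols n (replicate 1 p))) \<le> f x"
    using s'(2) replicate_in_multihypergraphs[OF p(1), of 1]
    unfolding optimal_def is_arg_max_linorder x_def by blast
  moreover have "degree_seq (mat_of_cols n (replicate 1 p)) = p"
    using degree_seq_replicate[of p n 1] p(1) by (auto simp: cube_layer_def)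
  ultimately show False using p(3) by (simp add: f_def)
qed

text \<open>With \<open>a = n div 2\<close> the binomial coefficient is at least \<open>(n / a) ^ a \<ge> 2 ^ a\<close>, which
  outgrows \<open>(6/5) ^ (2 * a + 1)\<close> because \<open>36/25 < 2\<close>.\<close>

lemma middle_binomial_ge_exponential:
  assumes "4 \<le> n"
  shows "(6/5) ^ n + 1 \<le> real (n choose (n div 2))"
proof -
  define a where "a = n div 2"
  have a: "2 \<le> a" "a \<le> n" "2 * a \<le> n" "n \<le> 2 * a + 1" using assms by (auto simp: a_def)
  have "(6/5 :: real) ^ n \<le> (6/5) ^ (2 * a + 1)"
    using a by (intro power_increasing) auto
  also have "\<dots> = 6/5 * (36/25) ^ a" by (simp add: power_mult power2_eq_square)
  also have "\<dots> + 1 \<le> 2 ^ a"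
    using a(1)
  proof (induction a rule: dec_induct)
    case base
    show ?case by (simp add: power2_eq_square)
  next
    case (step b)
    have "6/5 * (36/25) ^ Suc b + (1::real) \<le> 2 * (6/5 * (36/25) ^ b + 1)" by simp
    also have "\<dots> \<le> 2 ^ Suc b" using step.IH by simp
    finally show ?case .
  qed
  also have "(2::real) ^ a \<le> (real n / real a) ^ a"
    using a by (intro power_mono) (auto simp: field_simps)
  also have "\<dots> \<le> real (n choose a)"
    using binomial_ge_n_over_k_pow_k[of a n, where 'a=real] a by simp
  finally show ?thesis by (simp add: a_def)
qed

lemma solver_needs_exponential_time:
  assumes P: "\<And>n k f. admissible n k 1 f \<Longrightarrow> \<exists>t. solves_in P n k 1 f t" and n: "4 \<le> n"
  shows "\<exists>k f t. admissible n k 1 f \<and> solves_in P n k 1 f t \<and> (6/5) ^ n \<le> real t"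
proof -
  define k where "k = n div 2"
  have k: "1 \<le> k" "k \<le> n" using n by (auto simp: k_def)
  have adm: "admissible n k 1 (\<lambda>_. 0)"
    using k by (simp add: admissible_def convex_on_grid_zero)
  then obtain t where t: "solves_in P n k 1 (\<lambda>_. 0) t" using P by blast
  have "(6/5) ^ n + 1 \<le> real (n choose k)"
    unfolding k_def using n by (rule middle_binomial_ge_exponential)
  also have "\<dots> \<le> real (t + 1)"
    using binomial_le_solver_time[OF P k t] of_nat_mono by blast
  finally show ?thesis using adm t by auto
qed

section \<open>The theorem\<close>

theorem theorem6p1:
  shows "(\<forall>(n::nat) (k::nat) (m::nat) (f :: nat vec \<Rightarrow> real). admissible n k m f \<longrightarrow>
            (\<exists>x. is_arg_max (\<lambda>x. f (m \<cdot>\<^sub>v x)) (\<lambda>x. x \<in> cube_layer n k) x \<and>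
                 optimal n k m f (mat_of_cols n (replicate m x))))
       \<and> (\<forall>k::nat. 1 \<le> k \<longrightarrow>
            (\<exists>(P::prog) (c::nat) (d::nat). \<forall>(n::nat) (m::nat) (f :: nat vec \<Rightarrow> real).
               admissible n k m f \<longrightarrow> (\<exists>t. solves_in P n k m f t \<and> t \<le> c * (n + m) ^ d)))
       \<and> (\<exists>b::real. b > 1 \<and>
            (\<forall>P::prog. (\<forall>(n::nat) (k::nat) (f :: nat vec \<Rightarrow> real).
                 admissible n k 1 f \<longrightarrow> (\<exists>t. solves_in P n k 1 f t)) \<longrightarrow>
               (\<exists>n0::nat. \<forall>n\<ge>n0. \<exists>(k::nat) (f :: nat vec \<Rightarrow> real) (t::nat).
                  admissible n k 1 f \<and> solves_in P n k 1 f t \<and> b ^ n \<le> real t)))"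
proof (intro conjI allI impI)
  fix n k m :: nat and f :: "nat vec \<Rightarrow> real"
  assume "admissible n k m f"
  then show "\<exists>x. is_arg_max (\<lambda>x. f (m \<cdot>\<^sub>v x)) (\<lambda>x. x \<in> cube_layer n k) x \<and>
      optimal n k m f (mat_of_cols n (replicate m x))"
    by (blast elim: exists_replicate_optimal)
next
  fix k :: nat
  show "\<exists>P c d. \<forall>n m f. admissible n k m f \<longrightarrow>
      (\<exists>t. solves_in P n k m f t \<and> t \<le> c * (n + m) ^ d)"
    using solver_polynomial by blast
next
  show "\<exists>b::real. b > 1 \<and>
      (\<forall>P. (\<forall>n k f. admissible n k 1 f \<longrightarrow> (\<exists>t. solves_in P n k 1 f t)) \<longrightarrow>
        (\<exists>n0. \<forall>n\<ge>n0. \<exists>k f t. admissible n k 1 f \<and> solves_in P n k 1 f t \<and> b ^ n \<le> real t))"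
  proof (intro exI[of _ "6/5"] conjI allI impI)
    fix P
    assume P: "\<forall>n k f. admissible n k 1 f \<longrightarrow> (\<exists>t. solves_in P n k 1 f t)"
    have "\<exists>k f t. admissible n k 1 f \<and> solves_in P n k 1 f t \<and> (6/5) ^ n \<le> real t"
      if "4 \<le> n" for n
      using P that by (intro solver_needs_exponential_time) blast+
    then show "\<exists>n0. \<forall>n\<ge>n0. \<exists>k f t. admissible n k 1 f \<and> solves_in P n k 1 f t \<and>
        (6/5) ^ n \<le> real t"
      by blast
  qed simp
qed

end
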